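(* Let $X$ be a metrizable separable zero-dimensional space and let $\mathcal S$ be a countable clopen base of $X$ closed under finite unions and complements. If $Y_{\mathcal S}=\{\chi_S:S\in\mathcal S\}$ is H-nw-selective as a subspace of $C_p(X,2)$, then for every sequence $\langle\mathcal C_n:n\in\omega\rangle$ of countable closed $\omega$-covers of $X$ there exists a $\gamma_{fs}$-sequence $\langle\mathcal D_n:n\in\omega\rangle$ on $X$ such that $\mathcal D_n\in[\mathcal C_n]^{<\omega}$ for all $n\in\omega$.
   Context: $C_p(X,2)$ is the space of continuous functions from $X$ to the discrete space $2=\{0,1\}$ with the topology of pointwise convergence. For $A\subseteq X$, $\chi_A:X\to 2$ is defined by: $\chi_A(x)=0$ iff $x\in A$. An $\omega$-cover of $X$ is a cover of $X$ such that every finite subset of $X$ is contained in some member; it is closed if all its members are closed in $X$. $[\mathcal C]^{<\omega}$ is the family of finite subsets of $\mathcal C$. A sequence $\langle\mathcal U_n:n\in\omega\rangle$ of finite families of subsets of $X$ is a $\gamma_{fs}$-sequence on $X$ if for every finite $F\subseteq X$ there exists $n\in\omega$ such that for all $k\geq n$ there exists $U\in\mathcal U_k$ containing $F$. A network for a space $Z$ is a family $\mathcal N$ of subsets of $Z$ such that for every $x\in Z$ and every open neighbourhood $U$ of $x$ there is $N\in\mathcal N$ with $x\in N\subseteq U$; $nw(Z)=\omega$ is understood as: $Z$ has a countable network. $Z$ is H-nw-selective if $nw(Z)=\omega$ and for every sequence $(\mathcal N_n:n\in\omega)$ of countable networks for $Z$ one can select finite $\mathcal F_n\subset\mathcal N_n$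 such that for any $x\in Z$ and any open neighbourhood $U$ of $x$ there is $k\in\omega$ such that for every $n\geq k$ there is $A\in\mathcal F_n$ with $x\in A\subseteq U$. *)

theory Defs
  imports "HOL-Analysis.Analysis"
begin

definition clopen_base :: "'a topology \<Rightarrow> 'a set set \<Rightarrow> bool" where
  "clopen_base X \<S> \<longleftrightarrow>
     (\<forall>S\<in>\<S>. openin X S \<and> closedin X S) \<and> openin X = arbitrary union_of (\<lambda>S. S \<in> \<S>)"

(* The empty space is included. *)
definition zero_dimensional_space :: "'a topology \<Rightarrow> bool" where
  "zero_dimensional_space X \<longleftrightarrow> (\<exists>\<B>. clopen_base X \<B>)"

abbreviation two_space :: "nat topology" where
  "two_space \<equiv> discrete_topology {0, 1}"

(* The points of the product are extensional functions on the carrier of X. *)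
definition Cp2 :: "'a topology \<Rightarrow> ('a \<Rightarrow> nat) topology" where
  "Cp2 X = subtopology (product_topology (\<lambda>_. two_space) (topspace X))
             {f. continuous_map X two_space f}"

(* The value on A is 0, the opposite of the library's indicator. *)
definition chi :: "'a topology \<Rightarrow> 'a set \<Rightarrow> 'a \<Rightarrow> nat" where
  "chi X A = (\<lambda>x\<in>topspace X. if x \<in> A then 0 else 1)"

definition closed_omega_cover :: "'a topology \<Rightarrow> 'a set set \<Rightarrow> bool" where
  "closed_omega_cover X \<C> \<longleftrightarrow>
     (\<forall>C\<in>\<C>. closedin X C) \<and> \<Union>\<C> = topspace X \<and>
     (\<forall>F. finite F \<and> F \<subseteq> topspace X \<longrightarrow> (\<exists>C\<in>\<C>. F \<subseteq> C))"

definition gamma_fs_sequence :: "'a topology \<Rightarrow> (nat \<Rightarrow> 'a set set) \<Rightarrow> bool" where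
  "gamma_fs_sequence X \<U> \<longleftrightarrow>
     (\<forall>n. finite (\<U> n) \<and> (\<forall>U\<in>\<U> n. U \<subseteq> topspace X)) \<and>
     (\<forall>F. finite F \<and> F \<subseteq> topspace X \<longrightarrow> (\<exists>n. \<forall>k\<ge>n. \<exists>U\<in>\<U> k. F \<subseteq> U))"

definition network :: "'a topology \<Rightarrow> 'a set set \<Rightarrow> bool" where
  "network Z \<N> \<longleftrightarrow>
     (\<forall>N\<in>\<N>. N \<subseteq> topspace Z) \<and>
     (\<forall>x U. openin Z U \<and> x \<in> U \<longrightarrow> (\<exists>N\<in>\<N>. x \<in> N \<and> N \<subseteq> U))"

definition H_nw_selective :: "'a topology \<Rightarrow> bool" where
  "H_nw_selective Z \<longleftrightarrow>
     (\<exists>\<N>. countable \<N> \<and> network Z \<N>) \<and>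
     (\<forall>\<N>. (\<forall>n::nat. countable (\<N> n) \<and> network Z (\<N> n)) \<longrightarrow>
        (\<exists>\<F>. (\<forall>n. finite (\<F> n) \<and> \<F> n \<subseteq> \<N> n) \<and>
           (\<forall>x U. openin Z U \<and> x \<in> U \<longrightarrow>
              (\<exists>k. \<forall>n\<ge>k. \<exists>A\<in>\<F> n. x \<in> A \<and> A \<subseteq> U))))"

end

theory Submission
  imports Defs
begin

text \<open>
  The idea is to turn an \<open>\<omega>\<close>-cover \<open>\<C>\<close> into a network of the space \<open>Y\<close> of all \<open>chi X S\<close> with
  \<open>S \<in> \<S>\<close>, and to read the selected members of that network at the single point
  \<open>chi X (topspace X)\<close>, the constant function \<open>0\<close>.

  A basic neighbourhood of \<open>chi X S\<close> consists of the functions agreeing with it on a finite set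
  \<open>F\<close>. Enlarging \<open>F\<close> to a member \<open>C\<close> of the \<open>\<omega>\<close>-cover gives the smaller set of all \<open>chi X T\<close> with
  \<open>T \<inter> C = S \<inter> C\<close>; hence these sets, for \<open>C \<in> \<C>\<close> and \<open>S \<in> \<S>\<close>, form a network
  (\<open>network_traces\<close>), and there are only countably many of them.

  Conversely, if such a set contains the constant \<open>0\<close>, then it consists of all \<open>chi X T\<close> with
  \<open>C \<subseteq> T\<close>. If moreover all its members vanish on \<open>F\<close>, then every \<open>T \<in> \<S>\<close> that includes
  \<open>C\<close> includes \<open>F\<close>. A closed set is the intersection of the members of \<open>\<S>\<close> that include it
  (\<open>closed_separated_by_clopen_base\<close>), so \<open>F \<subseteq> C\<close>. Thus a selection from these networks that
  eventually catches every neighbourhood of the constant \<open>0\<close> yields finite subfamilies of the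
  covers that eventually catch every finite \<open>F\<close>.
\<close>

section \<open>Pointwise convergence on continuous two-valued functions\<close>

lemma chi_apply: "x \<in> topspace X \<Longrightarrow> chi X A x = (if x \<in> A then 0 else 1)"
  by (simp add: chi_def)

lemma topspace_Cp2:
  "topspace (Cp2 X) = {f \<in> topspace X \<rightarrow>\<^sub>E {0, 1}. continuous_map X two_space f}"
  by (auto simp: Cp2_def)

lemma chi_in_Cp2:
  assumes "openin X S" "closedin X S"
  shows "chi X S \<in> topspace (Cp2 X)"
proof -
  have "openin X {x \<in> topspace X. chi X S x \<in> U}" for U
  proof -
    have "{x \<in> topspace X. chi X S x \<in> U} =
        (if 0 \<in> U then S else {}) \<union> (if 1 \<in> U then topspace X - S else {})"
      using openin_subset[OF assms(1)] by (auto simp: chi_apply split: if_splits)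
    then show ?thesis
      using assms by (auto intro!: openin_Un)
  qed
  then have "continuous_map X two_space (chi X S)"
    by (auto simp: continuous_map_def chi_apply)
  then show ?thesis
    by (auto simp: topspace_Cp2 chi_def)
qed

lemma openin_Cp2_agree:
  assumes "finite F" "F \<subseteq> topspace X"
  shows "openin (Cp2 X) {f \<in> topspace (Cp2 X). \<forall>x\<in>F. f x = g x}"
proof -
  have val: "f x \<in> {0, 1}" if "f \<in> topspace (Cp2 X)" "x \<in> F" for f x
    using that assms(2) unfolding topspace_Cp2 by blast
  have "openin (Cp2 X) {f \<in> topspace (Cp2 X). f x \<in> {g x} \<inter> {0, 1}}" if "x \<in> F" for x
  proof (rule openin_continuous_map_preimage)
    show "continuous_map (Cp2 X) two_space (\<lambda>f. f x)"
      unfolding Cp2_def using assms that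
      by (intro continuous_map_from_subtopology continuous_map_product_projection) auto
  qed simp
  then have "openin (Cp2 X) (topspace (Cp2 X) \<inter>
      (\<Inter>x\<in>F. {f \<in> topspace (Cp2 X). f x \<in> {g x} \<inter> {0, 1}}))"
    using assms(1) by (intro openin_Int_Inter) auto
  moreover have "topspace (Cp2 X) \<inter> (\<Inter>x\<in>F. {f \<in> topspace (Cp2 X). f x \<in> {g x} \<inter> {0, 1}}) =
      {f \<in> topspace (Cp2 X). \<forall>x\<in>F. f x = g x}"
    using val by blast
  ultimately show ?thesis by simp
qed

lemma openin_Cp2_contains_agree:
  assumes "openin (Cp2 X) U" "g \<in> U"
  obtains F where "finite F" "F \<subseteq> topspace X"
    "\<And>f. f \<in> topspace (Cp2 X) \<Longrightarrow> (\<And>x. x \<in> F \<Longrightarrow> f x = g x) \<Longrightarrow> f \<in> U"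
proof -
  obtain V where V: "openin (product_topology (\<lambda>_. two_space) (topspace X)) V"
      and U: "U = V \<inter> {f. continuous_map X two_space f}"
    using assms(1) unfolding Cp2_def openin_subtopology by blast
  then obtain W where W: "finite {x \<in> topspace X. W x \<noteq> {0, 1}}"
      "g \<in> Pi\<^sub>E (topspace X) W" "Pi\<^sub>E (topspace X) W \<subseteq> V"
    using assms(2) unfolding openin_product_topology_alt U by fastforce
  show thesis
  proof (rule that[OF W(1)])
    fix f
    assume f: "f \<in> topspace (Cp2 X)" and eq: "\<And>x. x \<in> {x \<in> topspace X. W x \<noteq> {0, 1}} \<Longrightarrow> f x = g x"
    have "f x \<in> W x" if "x \<in> topspace X" for x
    proof (cases "W x = {0, 1}")
      case True
      then show ?thesis using f that by (auto simp: topspace_Cp2)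
    next
      case False
      then show ?thesis using eq[of x] W(2) that by auto
    qed
    then have "f \<in> Pi\<^sub>E (topspace X) W"
      using f by (auto simp: topspace_Cp2 PiE_def)
    then show "f \<in> U"
      using W(3) f unfolding U by (auto simp: topspace_Cp2)
  qed auto
qed

section \<open>Networks from covers\<close>

definition trace_class :: "'a topology \<Rightarrow> 'a set set \<Rightarrow> 'a set \<Rightarrow> 'a set \<Rightarrow> ('a \<Rightarrow> nat) set" where
  "trace_class X \<S> C S = chi X ` {T \<in> \<S>. T \<inter> C = S \<inter> C}"

text \<open>Shrinking a basic neighbourhood from agreement on a finite \<open>F\<close> to agreement on a member of
  the cover that includes \<open>F\<close> keeps its centre; this is all that a network requires. The sets
  obtained need not be open, which is why networks and not bases appear.\<close>

lemma network_traces: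
  assumes clopen: "\<And>S. S \<in> \<S> \<Longrightarrow> openin X S \<and> closedin X S"
    and cover: "closed_omega_cover X \<C>"
  shows "network (subtopology (Cp2 X) (chi X ` \<S>))
           ((\<lambda>(C, S). trace_class X \<S> C S) ` (\<C> \<times> \<S>))"
  unfolding network_def
proof (intro conjI ballI allI impI)
  fix N
  assume "N \<in> (\<lambda>(C, S). trace_class X \<S> C S) ` (\<C> \<times> \<S>)"
  then show "N \<subseteq> topspace (subtopology (Cp2 X) (chi X ` \<S>))"
    using clopen by (auto simp: trace_class_def chi_in_Cp2)
next
  fix f U
  assume "openin (subtopology (Cp2 X) (chi X ` \<S>)) U \<and> f \<in> U"
  then obtain V S where V: "openin (Cp2 X) V" "f \<in> V"
      and U: "U = V \<inter> chi X ` \<S>" and S: "S \<in> \<S>" "f = chi X S"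
    unfolding openin_subtopology by blast
  obtain F where F: "finite F" "F \<subseteq> topspace X"
      "\<And>h. h \<in> topspace (Cp2 X) \<Longrightarrow> (\<And>x. x \<in> F \<Longrightarrow> h x = f x) \<Longrightarrow> h \<in> V"
    using openin_Cp2_contains_agree[OF V] by blast
  obtain C where C: "C \<in> \<C>" "F \<subseteq> C"
    using cover F unfolding closed_omega_cover_def by blast
  have "chi X T \<in> U" if T: "T \<in> \<S>" "T \<inter> C = S \<inter> C" for T
  proof -
    have "chi X T x = f x" if "x \<in> F" for x
      using that T(2) C(2) F(2) S(2) by (auto simp: chi_apply subset_iff)
    then show ?thesis
      unfolding U using F(3) clopen T(1) chi_in_Cp2 by blast
  qed
  then have "f \<in> trace_class X \<S> C S" "trace_class X \<S> C S \<subseteq> U"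
    using S by (auto simp: trace_class_def)
  then show "\<exists>N\<in>(\<lambda>(C, S). trace_class X \<S> C S) ` (\<C> \<times> \<S>). f \<in> N \<and> N \<subseteq> U"
    using C(1) S(1) by auto
qed

section \<open>Recovering the cover at the constant zero function\<close>

lemma closed_separated_by_clopen_base:
  assumes base: "clopen_base X \<S>"
    and compl: "\<And>S. S \<in> \<S> \<Longrightarrow> topspace X - S \<in> \<S>"
    and C: "closedin X C" and x: "x \<in> topspace X" "x \<notin> C"
  obtains T where "T \<in> \<S>" "C \<subseteq> T" "x \<notin> T"
proof -
  have "(arbitrary union_of (\<lambda>S. S \<in> \<S>)) (topspace X - C)"
    using base C by (auto simp: clopen_base_def closedin_def)
  then obtain S where "S \<in> \<S>" "x \<in> S" "S \<subseteq> topspace X - C"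
    using x by (force simp: arbitrary_union_of_alt)
  then show thesis
    using that[of "topspace X - S"] compl closedin_subset[OF C] by auto
qed

text \<open>Containing the constant \<open>0\<close> forces \<open>C \<subseteq> S\<close>, so the trace class is that of all \<open>T\<close> including
  \<open>C\<close>, and separating \<open>C\<close> from its outside points turns vanishing on \<open>F\<close> into \<open>F \<subseteq> C\<close>. The
  representation of the class by \<open>C\<close> and \<open>S\<close> is arbitrary, so any choice of representatives will
  serve later.\<close>

lemma trace_class_vanishing_imp_subset:
  assumes base: "clopen_base X \<S>"
    and compl: "\<And>S. S \<in> \<S> \<Longrightarrow> topspace X - S \<in> \<S>"
    and C: "closedin X C" and F: "F \<subseteq> topspace X"
    and zero: "chi X (topspace X) \<in> trace_class X \<S> C S"
    and vanish: "\<And>f x. f \<in> trace_class X \<S> C S \<Longrightarrow> x \<in> F \<Longrightarrow> f x = 0"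
  shows "F \<subseteq> C"
proof
  fix x assume x: "x \<in> F"
  have CX: "C \<subseteq> topspace X" by (rule closedin_subset[OF C])
  obtain T0 where T0: "chi X (topspace X) = chi X T0" "T0 \<inter> C = S \<inter> C"
    using zero by (auto simp: trace_class_def)
  have "y \<in> T0" if "y \<in> C" for y
    using fun_cong[OF T0(1), of y] that CX by (auto simp: chi_apply subset_iff split: if_splits)
  then have CS: "C \<subseteq> S" using T0(2) by blast
  show "x \<in> C"
  proof (rule ccontr)
    assume "x \<notin> C"
    then obtain T where T: "T \<in> \<S>" "C \<subseteq> T" "x \<notin> T"
      using closed_separated_by_clopen_base[OF base compl C, of x] x F by blast
    then have "chi X T \<in> trace_class X \<S> C S"
      using CS by (auto simp: trace_class_def)
    then show False
      using vanish[of "chi X T" x] x F T(3) by (auto simp: chi_apply)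
  qed
qed

theorem theorem4p3:
  fixes X :: "'a topology" and \<S> :: "'a set set"
  assumes "metrizable_space X" and "separable_space X" and "zero_dimensional_space X"
    and "countable \<S>" and "clopen_base X \<S>"
    and "\<And>\<F>. finite \<F> \<Longrightarrow> \<F> \<noteq> {} \<Longrightarrow> \<F> \<subseteq> \<S> \<Longrightarrow> \<Union>\<F> \<in> \<S>"
    and "\<And>S. S \<in> \<S> \<Longrightarrow> topspace X - S \<in> \<S>"
    and "H_nw_selective (subtopology (Cp2 X) (chi X ` \<S>))"
  shows "\<forall>\<C> :: nat \<Rightarrow> 'a set set.
           (\<forall>n. countable (\<C> n) \<and> closed_omega_cover X (\<C> n)) \<longrightarrow>
           (\<exists>\<D>. gamma_fs_sequence X \<D> \<and> (\<forall>n. finite (\<D> n) \<and> \<D> n \<subseteq> \<C> n))"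
proof (intro allI impI)
  fix \<C> :: "nat \<Rightarrow> 'a set set"
  assume \<C>: "\<forall>n. countable (\<C> n) \<and> closed_omega_cover X (\<C> n)"
  let ?Y = "subtopology (Cp2 X) (chi X ` \<S>)"
  have clopen: "openin X S \<and> closedin X S" if "S \<in> \<S>" for S
    using assms(5) that unfolding clopen_base_def by blast
  have closed: "closedin X C" if "C \<in> \<C> n" for C n
    using \<C> that by (auto simp: closed_omega_cover_def)
  show "\<exists>\<D>. gamma_fs_sequence X \<D> \<and> (\<forall>n. finite (\<D> n) \<and> \<D> n \<subseteq> \<C> n)"
  proof (cases "\<S> = {}")
    \<comment> \<open>The closure condition concerns nonempty unions only, so \<open>\<S>\<close> may be empty; then \<open>X\<close> is
      empty and one member of each cover suffices.\<close>
    case True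
    have "(arbitrary union_of (\<lambda>S. S \<in> \<S>)) (topspace X)"
      using assms(5) openin_topspace[of X] by (simp add: clopen_base_def)
    then have empty: "topspace X = {}"
      using True by (auto simp: arbitrary_union_of_alt)
    have "\<forall>n. \<exists>C. C \<in> \<C> n"
      using \<C> unfolding closed_omega_cover_def by blast
    then obtain c where c: "\<And>n. c n \<in> \<C> n" by metis
    have "gamma_fs_sequence X (\<lambda>n. {c n})"
      using closedin_subset[OF closed[OF c]] empty by (auto simp: gamma_fs_sequence_def)
    then show ?thesis using c by (intro exI[of _ "\<lambda>n. {c n}"]) auto
  next
    case False
    then obtain S where "S \<in> \<S>" by blast
    then have X: "topspace X \<in> \<S>"
      using assms(6)[of "{S, topspace X - S}"] assms(7)[of S] clopen[of S]
      by (auto simp: Un_absorb1 closedin_subset)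
    let ?z = "chi X (topspace X)"
    let ?N = "\<lambda>n. (\<lambda>(C, S). trace_class X \<S> C S) ` (\<C> n \<times> \<S>)"
    have networks: "\<forall>n. countable (?N n) \<and> network ?Y (?N n)"
      using \<C> assms(4) network_traces[OF clopen] by auto
    obtain \<F> where sel: "\<forall>n. finite (\<F> n) \<and> \<F> n \<subseteq> ?N n"
        and catch: "\<forall>f U. openin ?Y U \<and> f \<in> U \<longrightarrow> (\<exists>k. \<forall>n\<ge>k. \<exists>A\<in>\<F> n. f \<in> A \<and> A \<subseteq> U)"
      using assms(8)[unfolded H_nw_selective_def, THEN conjunct2,
          THEN spec[of _ ?N], THEN mp, OF networks]
      by (elim exE conjE) (rule that)
    have \<F>: "finite (\<F> n)" "\<F> n \<subseteq> ?N n" for n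
      using sel by auto
    have "\<forall>n A. \<exists>C. A \<in> \<F> n \<longrightarrow> C \<in> \<C> n \<and> (\<exists>S. A = trace_class X \<S> C S)"
      using \<F>(2) by fast
    then obtain c where c: "\<And>n A. A \<in> \<F> n \<Longrightarrow> c n A \<in> \<C> n"
        and trace: "\<And>n A. A \<in> \<F> n \<Longrightarrow> \<exists>S. A = trace_class X \<S> (c n A) S"
      by metis
    have "\<exists>k. \<forall>n\<ge>k. \<exists>C\<in>c n ` \<F> n. F \<subseteq> C" if F: "finite F" "F \<subseteq> topspace X" for F
    proof -
      let ?U = "{f \<in> topspace (Cp2 X). \<forall>x\<in>F. f x = ?z x} \<inter> chi X ` \<S>"
      have "openin ?Y ?U"
        using openin_Cp2_agree[OF F] unfolding openin_subtopology by blast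
      moreover have "?z \<in> ?U"
        using X clopen chi_in_Cp2 by auto
      ultimately obtain k where k: "\<And>n. n \<ge> k \<Longrightarrow> \<exists>A\<in>\<F> n. ?z \<in> A \<and> A \<subseteq> ?U"
        using catch[rule_format, of ?U ?z] by blast
      have "\<exists>C\<in>c n ` \<F> n. F \<subseteq> C" if n: "n \<ge> k" for n
      proof -
        obtain A where A: "A \<in> \<F> n" "?z \<in> A" "A \<subseteq> ?U" using k[OF n] by blast
        obtain S where S: "A = trace_class X \<S> (c n A) S" using trace[OF A(1)] by blast
        have "F \<subseteq> c n A"
        proof (rule trace_class_vanishing_imp_subset[OF assms(5,7) closed[OF c[OF A(1)]] F(2)])
          show "?z \<in> trace_class X \<S> (c n A) S" using A(2) S by simp
          show "f x = 0" if "f \<in> trace_class X \<S> (c n A) S" "x \<in> F" for f x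
            using that A(3) S F(2) by (auto simp: chi_apply subset_iff)
        qed auto
        then show ?thesis using A(1) by blast
      qed
      then show ?thesis by blast
    qed
    then have "gamma_fs_sequence X (\<lambda>n. c n ` \<F> n)"
      using \<F>(1) closedin_subset[OF closed[OF c]] by (auto simp: gamma_fs_sequence_def)
    then show ?thesis
      using \<F>(1) c by (intro exI[of _ "\<lambda>n. c n ` \<F> n"]) auto
  qed
qed

end
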